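(* Consider finite structures of a fixed finite signature (possibly with operations of positive arity). (i) A property $\mathcal{P}$ of finite structures is not expressible in first order logic if for every $n\in\mathbb{N}$ there exist two finite structures $\mathbf{A}_n$ and $\mathbf{B}_n$ such that $\mathbf{A}_n\equiv_n\mathbf{B}_n$, and $\mathbf{A}_n$ has property $\mathcal{P}$ while $\mathbf{B}_n$ does not. (ii) When relativised to any uniformly locally finite class of finite structures, the converse also holds: if $\mathscr{U}$ is a uniformly locally finite class of finite structures and the property $\mathcal{P}$ is not expressible in first order logic within $\mathscr{U}$ (there is no first order sentence $\Phi$ such that for all $\mathbf{A}\in\mathscr{U}$, $\mathbf{A}\models\Phi$ if and only if $\mathbf{A}$ has property $\mathcal{P}$), then for every $n\in\mathbb{N}$ there exist $\mathbf{A}_n,\mathbf{B}_n\in\mathscr{U}$ such that $\mathbf{A}_n\equiv_n\mathbf{B}_n$, and $\mathbf{A}_n$ has property $\mathcal{P}$ while $\mathbf{B}_n$ does not.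
   Context: The relation $\equiv_n$ is defined by the following $n$-round Ehrenfeucht-Fraïssé game between Spoiler and Duplicator on two finite structures $\mathbf{A},\mathbf{B}$ of the same finite signature. In each round Spoiler picks one of the two structures and selects an element of it, and Duplicator responds by selecting an element of the other structure. After $n$ rounds, elements $a_1,\dots,a_n$ of $A$ and $b_1,\dots,b_n$ of $B$ have been selected ($a_i,b_i$ in round $i$). Duplicator wins if the map $a_i\mapsto b_i$ extends to an isomorphism between the substructure of $\mathbf{A}$ generated by $\{a_1,\dots,a_n\}$ and the substructure of $\mathbf{B}$ generated by $\{b_1,\dots,b_n\}$. Write $\mathbf{A}\equiv_n\mathbf{B}$ if Duplicator has a winning strategy for the $n$-round game. A class of structures is uniformly locally finite if for every $n$ there exists $m$ such that every $n$-generated substructure of a member of the class has at most $m$ elements. A property of structures is understood to be isomorphism invariant. A property $\mathcal P$ is expressible in first order logic if there is a first order sentence whose finite models are exactly the finite structures with property $\mathcal P$. *)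

theory Defs
  imports Main
begin

section \<open>Signatures and structures\<close>

record ('f, 'r) signature =
  ops :: "'f set"
  rels :: "'r set"
  op_arity :: "'f \<Rightarrow> nat"
  rel_arity :: "'r \<Rightarrow> nat"

definition finite_signature :: "('f, 'r) signature \<Rightarrow> bool" where
  "finite_signature S \<longleftrightarrow> finite (ops S) \<and> finite (rels S)"

text \<open>The interpretations are total functions on lists. Their values outside the carrier, at the
  wrong arity or at symbols outside the signature are arbitrary, and no notion below depends on
  them: structures that differ only there are isomorphic via the identity.\<close>

record ('f, 'r, 'a) struct =
  carrier :: "'a set"
  op_interp :: "'f \<Rightarrow> 'a list \<Rightarrow> 'a"
  rel_interp :: "'r \<Rightarrow> 'a list set"

definition tuples :: "'a set \<Rightarrow> nat \<Rightarrow> 'a list set" where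
  "tuples C k = {xs. length xs = k \<and> set xs \<subseteq> C}"

text \<open>Structures are non-empty, as usual in model theory; the substructure generated by the
  empty set may nevertheless be empty if there are no constants.\<close>

definition finite_structure :: "('f, 'r) signature \<Rightarrow> ('f, 'r, 'a) struct \<Rightarrow> bool" where
  "finite_structure S A \<longleftrightarrow> finite (carrier A) \<and> carrier A \<noteq> {} \<and>
     (\<forall>f\<in>ops S. \<forall>xs\<in>tuples (carrier A) (op_arity S f). op_interp A f xs \<in> carrier A)"

inductive_set generated :: "('f, 'r) signature \<Rightarrow> ('f, 'r, 'a) struct \<Rightarrow> 'a set \<Rightarrow> 'a set"
  for S :: "('f, 'r) signature" and A :: "('f, 'r, 'a) struct" and X :: "'a set" where
  gen_base: "x \<in> X \<Longrightarrow> x \<in> generated S A X"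
| gen_op: "f \<in> ops S \<Longrightarrow> length xs = op_arity S f \<Longrightarrow> (\<forall>x\<in>set xs. x \<in> generated S A X)
    \<Longrightarrow> op_interp A f xs \<in> generated S A X"

definition gen_substructure ::
    "('f, 'r) signature \<Rightarrow> ('f, 'r, 'a) struct \<Rightarrow> 'a set \<Rightarrow> ('f, 'r, 'a) struct" where
  "gen_substructure S A X = A\<lparr>carrier := generated S A X\<rparr>"

definition is_iso ::
    "('f, 'r) signature \<Rightarrow> ('f, 'r, 'a) struct \<Rightarrow> ('f, 'r, 'b) struct \<Rightarrow> ('a \<Rightarrow> 'b) \<Rightarrow> bool" where
  "is_iso S A B h \<longleftrightarrow> bij_betw h (carrier A) (carrier B) \<and>
     (\<forall>f\<in>ops S. \<forall>xs\<in>tuples (carrier A) (op_arity S f).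
        h (op_interp A f xs) = op_interp B f (map h xs)) \<and>
     (\<forall>r\<in>rels S. \<forall>xs\<in>tuples (carrier A) (rel_arity S r).
        xs \<in> rel_interp A r \<longleftrightarrow> map h xs \<in> rel_interp B r)"

text \<open>Properties are predicates on structures with elements in a type \<open>'a\<close>. If \<open>'a\<close> is infinite,
  every finite structure has an isomorphic copy with elements in \<open>'a\<close>.\<close>

definition iso_invariant :: "('f, 'r) signature \<Rightarrow> (('f, 'r, 'a) struct \<Rightarrow> bool) \<Rightarrow> bool" where
  "iso_invariant S P \<longleftrightarrow> (\<forall>A B h. finite_structure S A \<longrightarrow> finite_structure S B \<longrightarrow>
     is_iso S A B h \<longrightarrow> (P A \<longleftrightarrow> P B))"

definition uniformly_locally_finite ::
    "('f, 'r) signature \<Rightarrow> ('f, 'r, 'a) struct set \<Rightarrow> bool" where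
  "uniformly_locally_finite S U \<longleftrightarrow> (\<forall>n. \<exists>m. \<forall>A\<in>U. \<forall>X. X \<subseteq> carrier A \<longrightarrow>
     finite X \<longrightarrow> card X \<le> n \<longrightarrow> finite (generated S A X) \<and> card (generated S A X) \<le> m)"


section \<open>First order logic\<close>

datatype 'f tm = Var nat | App 'f "'f tm list"

datatype ('f, 'r) form =
    Eq "'f tm" "'f tm"
  | Rel 'r "'f tm list"
  | Neg "('f, 'r) form"
  | Conj "('f, 'r) form" "('f, 'r) form"
  | Disj "('f, 'r) form" "('f, 'r) form"
  | Ex nat "('f, 'r) form"
  | All nat "('f, 'r) form"

fun wf_tm :: "('f, 'r) signature \<Rightarrow> 'f tm \<Rightarrow> bool" where
  "wf_tm S (Var x) \<longleftrightarrow> True"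
| "wf_tm S (App f ts) \<longleftrightarrow> f \<in> ops S \<and> length ts = op_arity S f \<and> (\<forall>t\<in>set ts. wf_tm S t)"

fun wf_form :: "('f, 'r) signature \<Rightarrow> ('f, 'r) form \<Rightarrow> bool" where
  "wf_form S (Eq s t) \<longleftrightarrow> wf_tm S s \<and> wf_tm S t"
| "wf_form S (Rel r ts) \<longleftrightarrow>
     r \<in> rels S \<and> length ts = rel_arity S r \<and> (\<forall>t\<in>set ts. wf_tm S t)"
| "wf_form S (Neg p) \<longleftrightarrow> wf_form S p"
| "wf_form S (Conj p q) \<longleftrightarrow> wf_form S p \<and> wf_form S q"
| "wf_form S (Disj p q) \<longleftrightarrow> wf_form S p \<and> wf_form S q"
| "wf_form S (Ex x p) \<longleftrightarrow> wf_form S p"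
| "wf_form S (All x p) \<longleftrightarrow> wf_form S p"

fun tm_vars :: "'f tm \<Rightarrow> nat set" where
  "tm_vars (Var x) = {x}"
| "tm_vars (App f ts) = (\<Union>t\<in>set ts. tm_vars t)"

fun free_vars :: "('f, 'r) form \<Rightarrow> nat set" where
  "free_vars (Eq s t) = tm_vars s \<union> tm_vars t"
| "free_vars (Rel r ts) = (\<Union>t\<in>set ts. tm_vars t)"
| "free_vars (Neg p) = free_vars p"
| "free_vars (Conj p q) = free_vars p \<union> free_vars q"
| "free_vars (Disj p q) = free_vars p \<union> free_vars q"
| "free_vars (Ex x p) = free_vars p - {x}"
| "free_vars (All x p) = free_vars p - {x}"

definition sentence :: "('f, 'r) signature \<Rightarrow> ('f, 'r) form \<Rightarrow> bool" where
  "sentence S p \<longleftrightarrow> wf_form S p \<and> free_vars p = {}"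

fun tm_val :: "('f, 'r, 'a) struct \<Rightarrow> (nat \<Rightarrow> 'a) \<Rightarrow> 'f tm \<Rightarrow> 'a" where
  "tm_val A e (Var x) = e x"
| "tm_val A e (App f ts) = op_interp A f (map (tm_val A e) ts)"

fun sat :: "('f, 'r, 'a) struct \<Rightarrow> (nat \<Rightarrow> 'a) \<Rightarrow> ('f, 'r) form \<Rightarrow> bool" where
  "sat A e (Eq s t) \<longleftrightarrow> tm_val A e s = tm_val A e t"
| "sat A e (Rel r ts) \<longleftrightarrow> map (tm_val A e) ts \<in> rel_interp A r"
| "sat A e (Neg p) \<longleftrightarrow> \<not> sat A e p"
| "sat A e (Conj p q) \<longleftrightarrow> sat A e p \<and> sat A e q"
| "sat A e (Disj p q) \<longleftrightarrow> sat A e p \<or> sat A e q"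
| "sat A e (Ex x p) \<longleftrightarrow> (\<exists>a\<in>carrier A. sat A (e(x := a)) p)"
| "sat A e (All x p) \<longleftrightarrow> (\<forall>a\<in>carrier A. sat A (e(x := a)) p)"

definition models :: "('f, 'r, 'a) struct \<Rightarrow> ('f, 'r) form \<Rightarrow> bool" where
  "models A p \<longleftrightarrow> (\<forall>e. range e \<subseteq> carrier A \<longrightarrow> sat A e p)"

definition fo_expressible_within ::
    "('f, 'r) signature \<Rightarrow> ('f, 'r, 'a) struct set \<Rightarrow> (('f, 'r, 'a) struct \<Rightarrow> bool) \<Rightarrow> bool" where
  "fo_expressible_within S U P \<longleftrightarrow> (\<exists>p. sentence S p \<and> (\<forall>A\<in>U. models A p \<longleftrightarrow> P A))"

definition fo_expressible ::
    "('f, 'r) signature \<Rightarrow> (('f, 'r, 'a) struct \<Rightarrow> bool) \<Rightarrow> bool" where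
  "fo_expressible S P \<longleftrightarrow> fo_expressible_within S {A. finite_structure S A} P"


section \<open>The Ehrenfeucht-Fraisse game\<close>

text \<open>A move \<open>Inl a\<close> of Spoiler selects \<open>a\<close> in the first structure, \<open>Inr b\<close> selects \<open>b\<close> in the
  second one. A strategy of Duplicator consists of \<open>s\<close>, giving the replies to moves in the first
  structure, and \<open>t\<close>, for moves in the second structure; both see all of Spoiler's earlier moves
  (Duplicator's earlier replies are determined by these). \<open>play A B s t h ps\<close> says that \<open>ps\<close> is the
  list of pairs selected when Spoiler plays \<open>h\<close> and Duplicator follows \<open>s\<close> and \<open>t\<close>.\<close>

inductive play ::
    "('f, 'r, 'a) struct \<Rightarrow> ('f, 'r, 'b) struct \<Rightarrow>
     (('a + 'b) list \<Rightarrow> 'a \<Rightarrow> 'b) \<Rightarrow> (('a + 'b) list \<Rightarrow> 'b \<Rightarrow> 'a) \<Rightarrow>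
     ('a + 'b) list \<Rightarrow> ('a \<times> 'b) list \<Rightarrow> bool"
  for A :: "('f, 'r, 'a) struct" and B :: "('f, 'r, 'b) struct" and s and t where
  play_start: "play A B s t [] []"
| play_fst: "play A B s t h ps \<Longrightarrow> a \<in> carrier A \<Longrightarrow> play A B s t (h @ [Inl a]) (ps @ [(a, s h a)])"
| play_snd: "play A B s t h ps \<Longrightarrow> b \<in> carrier B \<Longrightarrow> play A B s t (h @ [Inr b]) (ps @ [(t h b, b)])"

definition duplicator_wins ::
    "('f, 'r) signature \<Rightarrow> ('f, 'r, 'a) struct \<Rightarrow> ('f, 'r, 'b) struct \<Rightarrow> ('a \<times> 'b) list \<Rightarrow> bool" where
  "duplicator_wins S A B ps \<longleftrightarrow>
     (\<exists>h. is_iso S (gen_substructure S A (fst ` set ps)) (gen_substructure S B (snd ` set ps)) h \<and>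
          (\<forall>(a, b)\<in>set ps. h a = b))"

text \<open>The first condition says that Duplicator's replies are legal moves.\<close>

definition winning_strategy ::
    "('f, 'r) signature \<Rightarrow> nat \<Rightarrow> ('f, 'r, 'a) struct \<Rightarrow> ('f, 'r, 'b) struct \<Rightarrow>
     (('a + 'b) list \<Rightarrow> 'a \<Rightarrow> 'b) \<Rightarrow> (('a + 'b) list \<Rightarrow> 'b \<Rightarrow> 'a) \<Rightarrow> bool" where
  "winning_strategy S n A B s t \<longleftrightarrow>
     (\<forall>h ps. play A B s t h ps \<longrightarrow> length ps \<le> n \<longrightarrow> set ps \<subseteq> carrier A \<times> carrier B) \<and>
     (\<forall>h ps. play A B s t h ps \<longrightarrow> length ps = n \<longrightarrow> duplicator_wins S A B ps)"

definition ef_equiv ::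
    "('f, 'r) signature \<Rightarrow> nat \<Rightarrow> ('f, 'r, 'a) struct \<Rightarrow> ('f, 'r, 'b) struct \<Rightarrow> bool" where
  "ef_equiv S n A B \<longleftrightarrow> (\<exists>s t. winning_strategy S n A B s t)"

end

theory Submission
  imports Defs
begin

text \<open>Both parts rest on the back-and-forth reformulation of the game: \<open>A \<equiv>\<^sub>n B\<close> holds iff from the
  empty position every move can be answered \<open>n\<close> times, ending in a position won by Duplicator.

  (i) Induction on formulas shows that positions from which Duplicator survives \<open>n\<close> more rounds
  agree on formulas of quantifier rank at most \<open>n\<close>. Terms may be arbitrarily deep here, since the
  winning isomorphism acts on the whole generated substructures.

  (ii) If all \<open>n\<close>-generated substructures have at most \<open>m\<close> elements, every element of such a
  substructure is the value of a term of depth at most \<open>m\<close>, because the chain of values of terms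
  of bounded depth grows strictly until it stabilises. Hence its isomorphism type is determined by
  finitely many atomic formulas, with terms of depth at most \<open>m + 1\<close>. Closing this finite set under
  complete Boolean types and one existential quantifier, \<open>n\<close> times, gives finitely many sentences
  that determine the \<open>\<equiv>\<^sub>n\<close>-class of a member of the given class.\<close>

section \<open>Back-and-forth systems\<close>

text \<open>The list records the pairs chosen so far, with \<open>n\<close> rounds still to come.
  Isomorphism is tested only once no rounds remain; \<open>back_forth_extends_to_win\<close> makes
  it usable at earlier positions.\<close>

fun back_forth ::
    "('f, 'r) signature \<Rightarrow> nat \<Rightarrow> ('f, 'r, 'a) struct \<Rightarrow> ('f, 'r, 'b) struct \<Rightarrow> ('a \<times> 'b) list \<Rightarrow> bool" where
  "back_forth S 0 A B ps \<longleftrightarrow> duplicator_wins S A B ps"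
| "back_forth S (Suc n) A B ps \<longleftrightarrow>
     (\<forall>a\<in>carrier A. \<exists>b\<in>carrier B. back_forth S n A B (ps @ [(a, b)])) \<and>
     (\<forall>b\<in>carrier B. \<exists>a\<in>carrier A. back_forth S n A B (ps @ [(a, b)]))"

text \<open>The replies prescribed by \<open>s\<close> and \<open>t\<close> are the witnesses. The
  induction carries a \<open>play\<close> along because these replies depend on the whole history
  \<open>h\<close>.\<close>

lemma winning_strategy_back_forth:
  assumes "winning_strategy S n A B s t"
  shows "play A B s t h ps \<Longrightarrow> length ps + k = n \<Longrightarrow> back_forth S k A B ps"
proof (induction k arbitrary: h ps)
  case 0
  then show ?case using assms by (auto simp: winning_strategy_def)
next
  case (Suc k)
  have legal: "set qs \<subseteq> carrier A \<times> carrier B" if "play A B s t g qs" "length qs \<le> n" for g qs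
    using assms that by (auto simp: winning_strategy_def)
  have "\<exists>b\<in>carrier B. back_forth S k A B (ps @ [(a, b)])" if "a \<in> carrier A" for a
  proof -
    have pl: "play A B s t (h @ [Inl a]) (ps @ [(a, s h a)])"
      using Suc.prems(1) that by (rule play_fst)
    have "s h a \<in> carrier B" using legal[OF pl] Suc.prems(2) by simp
    moreover have "back_forth S k A B (ps @ [(a, s h a)])"
      using Suc.IH[OF pl] Suc.prems(2) by simp
    ultimately show ?thesis by blast
  qed
  moreover have "\<exists>a\<in>carrier A. back_forth S k A B (ps @ [(a, b)])" if "b \<in> carrier B" for b
  proof -
    have pl: "play A B s t (h @ [Inr b]) (ps @ [(t h b, b)])"
      using Suc.prems(1) that by (rule play_snd)
    have "t h b \<in> carrier A" using legal[OF pl] Suc.prems(2) by simp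
    moreover have "back_forth S k A B (ps @ [(t h b, b)])"
      using Suc.IH[OF pl] Suc.prems(2) by simp
    ultimately show ?thesis by blast
  qed
  ultimately show ?case by simp
qed

text \<open>Witnesses are chosen as functions of the current position. A strategy sees only
  Spoiler's moves, so the position is first reconstructed from them.\<close>

lemma back_forth_winning_strategy:
  fixes A :: "('f, 'r, 'a) struct" and B :: "('f, 'r, 'b) struct"
  assumes "back_forth S n A B []"
  obtains s t where "winning_strategy S n A B s t"
proof -
  \<comment> \<open>The exponent \<open>n - Suc (length ps)\<close> is the number of rounds left
    after this reply.\<close>
  define u where
    "u ps a = (SOME b. b \<in> carrier B \<and> back_forth S (n - Suc (length ps)) A B (ps @ [(a, b)]))"
    for ps :: "('a \<times> 'b) list" and a
  define v where
    "v ps b = (SOME a. a \<in> carrier A \<and> back_forth S (n - Suc (length ps)) A B (ps @ [(a, b)]))"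
    for ps :: "('a \<times> 'b) list" and b
  \<comment> \<open>Replays the history from the empty position, inserting the chosen
    replies.\<close>
  define pos where
    "pos = foldl (\<lambda>ps m. ps @ [case m of Inl a \<Rightarrow> (a, u ps a) | Inr b \<Rightarrow> (v ps b, b)]) []"
  define s where "s h = u (pos h)" for h
  define t where "t h = v (pos h)" for h
  \<comment> \<open>The second part is guarded by \<open>length ps \<le> n\<close>: beyond round
    \<open>n\<close> the chosen replies carry no guarantee.\<close>
  have inv: "ps = pos h \<and> (length ps \<le> n \<longrightarrow>
      set ps \<subseteq> carrier A \<times> carrier B \<and> back_forth S (n - length ps) A B ps)"
    if "play A B s t h ps" for h ps
    using that
  proof (induction rule: play.induct)
    case play_start
    then show ?case using assms by (simp add: pos_def)
  next
    case (play_fst h ps a)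
    have "u ps a \<in> carrier B \<and> back_forth S (n - Suc (length ps)) A B (ps @ [(a, u ps a)])"
      if "Suc (length ps) \<le> n"
    proof -
      have eq: "Suc (n - Suc (length ps)) = n - length ps" using that by simp
      have "back_forth S (Suc (n - Suc (length ps))) A B ps"
        unfolding eq using play_fst.IH that by (meson Suc_leD)
      then have "\<exists>b. b \<in> carrier B \<and> back_forth S (n - Suc (length ps)) A B (ps @ [(a, b)])"
        using play_fst.hyps(2) by auto
      then show ?thesis unfolding u_def by (rule someI_ex)
    qed
    then show ?case using play_fst by (auto simp: s_def pos_def)
  next
    case (play_snd h ps b)
    have "v ps b \<in> carrier A \<and> back_forth S (n - Suc (length ps)) A B (ps @ [(v ps b, b)])"
      if "Suc (length ps) \<le> n"
    proof -
      have eq: "Suc (n - Suc (length ps)) = n - length ps" using that by simp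
      have "back_forth S (Suc (n - Suc (length ps))) A B ps"
        unfolding eq using play_snd.IH that by (meson Suc_leD)
      then have "\<exists>a. a \<in> carrier A \<and> back_forth S (n - Suc (length ps)) A B (ps @ [(a, b)])"
        using play_snd.hyps(2) by auto
      then show ?thesis unfolding v_def by (rule someI_ex)
    qed
    then show ?case using play_snd by (auto simp: t_def pos_def)
  qed
  have "winning_strategy S n A B s t"
    unfolding winning_strategy_def
  proof (intro conjI allI impI)
    fix h ps assume "play A B s t h ps" "length ps \<le> n"
    then show "set ps \<subseteq> carrier A \<times> carrier B" using inv by blast
  next
    fix h ps assume "play A B s t h ps" "length ps = n"
    then have "back_forth S 0 A B ps" using inv by (metis diff_self_eq_0 order_refl)
    then show "duplicator_wins S A B ps" by simp
  qed
  then show thesis by (rule that)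
qed

lemma ef_equiv_iff_back_forth: "ef_equiv S n A B \<longleftrightarrow> back_forth S n A B []"
proof
  assume "ef_equiv S n A B"
  then obtain s t where "winning_strategy S n A B s t" by (auto simp: ef_equiv_def)
  from winning_strategy_back_forth[OF this play_start] show "back_forth S n A B []" by simp
next
  assume "back_forth S n A B []"
  then show "ef_equiv S n A B"
    by (metis back_forth_winning_strategy ef_equiv_def)
qed

text \<open>Spoiler can spend the remaining rounds on arbitrary elements of the non-empty carrier of
  \<open>A\<close>. This lets atomic formulas be compared at positions where rounds are
  left.\<close>

lemma back_forth_extends_to_win:
  assumes "carrier A \<noteq> {}"
  shows "back_forth S n A B ps \<Longrightarrow> \<exists>qs. set ps \<subseteq> set qs \<and> duplicator_wins S A B qs"
proof (induction n arbitrary: ps)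
  case 0
  then show ?case by auto
next
  case (Suc n)
  then obtain a b where "back_forth S n A B (ps @ [(a, b)])" using assms by fastforce
  from Suc.IH[OF this] show ?case by auto
qed


section \<open>The game preserves formulas of bounded quantifier rank\<close>

fun quantifier_rank :: "('f, 'r) form \<Rightarrow> nat" where
  "quantifier_rank (Eq s t) = 0"
| "quantifier_rank (Rel r ts) = 0"
| "quantifier_rank (Neg p) = quantifier_rank p"
| "quantifier_rank (Conj p q) = max (quantifier_rank p) (quantifier_rank q)"
| "quantifier_rank (Disj p q) = max (quantifier_rank p) (quantifier_rank q)"
| "quantifier_rank (Ex x p) = Suc (quantifier_rank p)"
| "quantifier_rank (All x p) = Suc (quantifier_rank p)"

section \<open>Terms and atomic formulas under the winning isomorphism\<close>

lemma tm_val_generated: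
  "wf_tm S t \<Longrightarrow> e ` tm_vars t \<subseteq> X \<Longrightarrow> tm_val A e t \<in> generated S A X"
proof (induction t)
  case (Var x)
  then show ?case by (auto intro: gen_base)
next
  case (App f ts)
  have "tm_val A e t \<in> generated S A X" if "t \<in> set ts" for t
    using App that by fastforce
  then show ?case using App.prems by (auto intro!: gen_op)
qed

lemma iso_generated_tm_val:
  assumes "is_iso S (gen_substructure S A X) (gen_substructure S B Y) h"
  shows "wf_tm S t \<Longrightarrow> (\<And>x. x \<in> tm_vars t \<Longrightarrow> e x \<in> X \<and> h (e x) = e' x) \<Longrightarrow>
    h (tm_val A e t) = tm_val B e' t"
proof (induction t)
  case (App f ts)
  have "map (tm_val A e) ts \<in> tuples (generated S A X) (op_arity S f)"
    using App.prems by (fastforce simp: tuples_def intro!: tm_val_generated)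
  then have "h (op_interp A f (map (tm_val A e) ts)) = op_interp B f (map h (map (tm_val A e) ts))"
    using assms App.prems(1) unfolding is_iso_def gen_substructure_def by simp
  moreover have "map h (map (tm_val A e) ts) = map (tm_val B e') ts"
    using App by auto
  ultimately show ?case by (metis tm_val.simps(2))
qed simp

text \<open>The winning isomorphism sends the value of a term under \<open>e\<close> to its value
  under \<open>e'\<close>. Its injectivity transfers equations, and its compatibility with relations
  transfers the other atoms.\<close>

lemma duplicator_wins_literals:
  assumes "duplicator_wins S A B ps"
  shows "wf_tm S t1 \<Longrightarrow> wf_tm S t2 \<Longrightarrow> \<forall>x\<in>tm_vars t1 \<union> tm_vars t2. (e x, e' x) \<in> set ps \<Longrightarrow>
      tm_val A e t1 = tm_val A e t2 \<longleftrightarrow> tm_val B e' t1 = tm_val B e' t2"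
    and "wf_form S (Rel r ts) \<Longrightarrow> \<forall>x\<in>free_vars (Rel r ts). (e x, e' x) \<in> set ps \<Longrightarrow>
      map (tm_val A e) ts \<in> rel_interp A r \<longleftrightarrow> map (tm_val B e') ts \<in> rel_interp B r"
proof -
  let ?X = "fst ` set ps" and ?Y = "snd ` set ps"
  obtain h where iso: "is_iso S (gen_substructure S A ?X) (gen_substructure S B ?Y) h"
    and "\<forall>(a, b)\<in>set ps. h a = b"
    using assms unfolding duplicator_wins_def by blast
  then have h: "h a = b" if "(a, b) \<in> set ps" for a b using that by auto
  have inj: "inj_on h (generated S A ?X)"
    using iso by (simp add: is_iso_def gen_substructure_def bij_betw_def)
  have val: "h (tm_val A e t) = tm_val B e' t \<and> tm_val A e t \<in> generated S A ?X"
    if "wf_tm S t" "\<forall>x\<in>tm_vars t. (e x, e' x) \<in> set ps" for t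
    using that by (intro conjI iso_generated_tm_val[OF iso] tm_val_generated) (force dest: h)+
  show "tm_val A e t1 = tm_val A e t2 \<longleftrightarrow> tm_val B e' t1 = tm_val B e' t2"
    if "wf_tm S t1" "wf_tm S t2" "\<forall>x\<in>tm_vars t1 \<union> tm_vars t2. (e x, e' x) \<in> set ps"
    using that val[of t1] val[of t2] inj by (metis UnCI inj_on_eq_iff)
  show "map (tm_val A e) ts \<in> rel_interp A r \<longleftrightarrow> map (tm_val B e') ts \<in> rel_interp B r"
    if wf: "wf_form S (Rel r ts)" and vars: "\<forall>x\<in>free_vars (Rel r ts). (e x, e' x) \<in> set ps"
  proof -
    have ts: "h (tm_val A e t) = tm_val B e' t \<and> tm_val A e t \<in> generated S A ?X"
      if "t \<in> set ts" for t
      using wf vars that by (intro val) auto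
    then have "map (tm_val A e) ts \<in> tuples (generated S A ?X) (rel_arity S r)"
      using wf by (auto simp: tuples_def)
    then have "map (tm_val A e) ts \<in> rel_interp A r \<longleftrightarrow>
        map h (map (tm_val A e) ts) \<in> rel_interp B r"
      using iso wf unfolding is_iso_def gen_substructure_def by simp
    moreover have "map h (map (tm_val A e) ts) = map (tm_val B e') ts" using ts by simp
    ultimately show ?thesis by metis
  qed
qed

text \<open>Each quantifier consumes one round: the element it ranges over is Spoiler's move, and
  Duplicator's reply provides the matching value on the other side.\<close>

lemma back_forth_sat_iff:
  assumes "carrier A \<noteq> {}"
  shows "back_forth S n A B ps \<Longrightarrow> wf_form S p \<Longrightarrow> quantifier_rank p \<le> n \<Longrightarrow>
    \<forall>x\<in>free_vars p. (e x, e' x) \<in> set ps \<Longrightarrow> sat A e p \<longleftrightarrow> sat B e' p"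
proof (induction p arbitrary: n ps e e')
  case (Eq s t)
  \<comment> \<open>Rounds may remain at an atomic formula, so the game is first played to its end;
    the pairs already chosen persist.\<close>
  obtain qs where qs: "set ps \<subseteq> set qs" and win: "duplicator_wins S A B qs"
    using back_forth_extends_to_win[OF assms Eq.prems(1)] by blast
  have "\<forall>x\<in>tm_vars s \<union> tm_vars t. (e x, e' x) \<in> set qs"
    using Eq.prems(4) qs by (simp add: subset_iff)
  then show ?case
    using duplicator_wins_literals(1)[OF win, of s t e e'] Eq.prems(2) by simp
next
  case (Rel r ts)
  obtain qs where qs: "set ps \<subseteq> set qs" and win: "duplicator_wins S A B qs"
    using back_forth_extends_to_win[OF assms Rel.prems(1)] by blast
  have "\<forall>x\<in>free_vars (Rel r ts). (e x, e' x) \<in> set qs"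
    using Rel.prems(4) qs by blast
  then show ?case
    using duplicator_wins_literals(2)[OF win] Rel.prems(2) by (metis sat.simps(2))
next
  case (Neg p)
  from Neg.IH[OF Neg.prems(1), of e e'] Neg.prems show ?case by simp
next
  case (Conj p q)
  from Conj.IH(1)[OF Conj.prems(1), of e e'] Conj.IH(2)[OF Conj.prems(1), of e e'] Conj.prems
  show ?case by simp
next
  case (Disj p q)
  from Disj.IH(1)[OF Disj.prems(1), of e e'] Disj.IH(2)[OF Disj.prems(1), of e e'] Disj.prems
  show ?case by simp
next
  case (Ex x p)
  obtain m where m: "n = Suc m" "quantifier_rank p \<le> m" using Ex.prems(3) by (cases n) auto
  \<comment> \<open>After the update, \<open>x\<close> is matched by the new pair and every other
    free variable by an old one.\<close>
  have "sat A (e(x := a)) p \<longleftrightarrow> sat B (e'(x := b)) p"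
    if "back_forth S m A B (ps @ [(a, b)])" for a b
  proof (rule Ex.IH[OF that])
    show "\<forall>y\<in>free_vars p. ((e(x := a)) y, (e'(x := b)) y) \<in> set (ps @ [(a, b)])"
      using Ex.prems(4) by auto
  qed (use Ex.prems m in simp_all)
  then show ?case using Ex.prems(1) unfolding m(1) sat.simps back_forth.simps by blast
next
  case (All x p)
  obtain m where m: "n = Suc m" "quantifier_rank p \<le> m" using All.prems(3) by (cases n) auto
  have "sat A (e(x := a)) p \<longleftrightarrow> sat B (e'(x := b)) p"
    if "back_forth S m A B (ps @ [(a, b)])" for a b
  proof (rule All.IH[OF that])
    show "\<forall>y\<in>free_vars p. ((e(x := a)) y, (e'(x := b)) y) \<in> set (ps @ [(a, b)])"
      using All.prems(4) by auto
  qed (use All.prems m in simp_all)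
  then show ?case using All.prems(1) unfolding m(1) sat.simps back_forth.simps by blast
qed

text \<open>A sentence matches the empty position vacuously under any two valuations, so a constant
  valuation in \<open>A\<close> can be compared with an arbitrary one in \<open>B\<close>.\<close>

lemma ef_equiv_models:
  fixes A :: "('f, 'r, 'a) struct" and B :: "('f, 'r, 'b) struct"
  assumes "carrier A \<noteq> {}" "ef_equiv S n A B" "sentence S p" "quantifier_rank p \<le> n"
    and "models A p"
  shows "models B p"
  unfolding models_def
proof (intro allI impI)
  fix e' :: "nat \<Rightarrow> 'b"
  obtain a where "a \<in> carrier A" using assms(1) by blast
  then have "sat A (\<lambda>_. a) p" using assms(5) by (auto simp: models_def)
  then show "sat B e' p"
    using back_forth_sat_iff[OF assms(1), of S n B "[]" p "\<lambda>_. a" e'] assms(2-4)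
    by (simp add: ef_equiv_iff_back_forth sentence_def)
qed


section \<open>Terms of bounded depth\<close>

text \<open>The levels are cumulative, so their values form an increasing chain. Level
  \<open>0\<close> has only the variables below \<open>n\<close>; constants enter at level
  \<open>1\<close>.\<close>

fun terms_upto :: "('f, 'r) signature \<Rightarrow> nat \<Rightarrow> nat \<Rightarrow> 'f tm set" where
  "terms_upto S n 0 = Var ` {..<n}"
| "terms_upto S n (Suc d) = terms_upto S n d \<union>
     (\<Union>f\<in>ops S. App f ` {ts. set ts \<subseteq> terms_upto S n d \<and> length ts = op_arity S f})"

lemma finite_terms_upto: "finite (ops S) \<Longrightarrow> finite (terms_upto S n d)"
  by (induction d) (auto intro: finite_lists_length_eq)

lemma terms_upto_wf: "t \<in> terms_upto S n d \<Longrightarrow> wf_tm S t \<and> tm_vars t \<subseteq> {..<n}"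
proof (induction d arbitrary: t)
  case (Suc d)
  show ?case
  proof (cases "t \<in> terms_upto S n d")
    case True
    then show ?thesis by (rule Suc.IH)
  next
    case False
    then obtain f ts where t: "t = App f ts" "f \<in> ops S" "length ts = op_arity S f"
      and "set ts \<subseteq> terms_upto S n d"
      using Suc.prems by auto
    then have "wf_tm S u \<and> tm_vars u \<subseteq> {..<n}" if "u \<in> set ts" for u
      using Suc.IH that by blast
    then show ?thesis using t by (simp add: UN_least)
  qed
qed auto

lemma terms_upto_mono: "d \<le> d' \<Longrightarrow> terms_upto S n d \<subseteq> terms_upto S n d'"
  by (rule lift_Suc_mono_le) auto

lemma App_terms_upto:
  "f \<in> ops S \<Longrightarrow> length ts = op_arity S f \<Longrightarrow> set ts \<subseteq> terms_upto S n d \<Longrightarrow>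
   App f ts \<in> terms_upto S n (Suc d)"
  by auto

declare terms_upto.simps(2) [simp del]

lemma subset_image_list:
  assumes "set xs \<subseteq> f ` T"
  obtains ts where "set ts \<subseteq> T" "xs = map f ts"
proof -
  have "xs \<in> lists (f ` T)" using assms by (simp add: lists_eq_set)
  then have "xs \<in> map f ` lists T" by (simp only: lists_image)
  then show thesis using that by (auto simp: lists_eq_set)
qed

lemma generated_eq_terms_upto:
  assumes fin: "finite (generated S A (e ` {..<n}))"
    and card: "card (generated S A (e ` {..<n})) \<le> m"
  shows "generated S A (e ` {..<n}) = tm_val A e ` terms_upto S n m"
proof -
  define G where "G d = tm_val A e ` terms_upto S n d" for d
  let ?X = "e ` {..<n}"
  have sub: "G d \<subseteq> generated S A ?X" for d
    unfolding G_def
  proof (rule image_subsetI)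
    fix t assume "t \<in> terms_upto S n d"
    then have "wf_tm S t" "tm_vars t \<subseteq> {..<n}" using terms_upto_wf by blast+
    then show "tm_val A e t \<in> generated S A ?X" by (intro tm_val_generated image_mono)
  qed
  have mono: "d \<le> d' \<Longrightarrow> G d \<subseteq> G d'" for d d'
    unfolding G_def by (intro image_mono terms_upto_mono)
  \<comment> \<open>If the chain pauses at \<open>d\<close>, then \<open>G d\<close> contains the
    generators and is closed under the operations.\<close>
  have stable: "generated S A ?X \<subseteq> G d" if eq: "G (Suc d) = G d" for d
  proof
    fix x assume "x \<in> generated S A ?X"
    then show "x \<in> G d"
    proof (induction rule: generated.induct)
      case (gen_base x)
      then have "x \<in> G 0" by (auto simp: G_def image_image)
      then show ?case using mono[of 0 d] by (simp add: subset_iff)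
    next
      case (gen_op f xs)
      then have "set xs \<subseteq> G d" by blast
      then obtain ts where ts: "set ts \<subseteq> terms_upto S n d" "xs = map (tm_val A e) ts"
        unfolding G_def by (rule subset_image_list)
      then have "App f ts \<in> terms_upto S n (Suc d)"
        using gen_op.hyps(1,2) by (intro App_terms_upto) simp_all
      then have "tm_val A e (App f ts) \<in> G (Suc d)" unfolding G_def by (rule imageI)
      then show ?case by (simp add: eq ts(2))
    qed
  qed
  have "\<exists>d\<le>m. G (Suc d) = G d"
  proof (rule ccontr)
    assume no: "\<not> (\<exists>d\<le>m. G (Suc d) = G d)"
    \<comment> \<open>Each strict inclusion adds an element. The count starts from zero because
      \<open>G 0\<close> may be empty; without a pause up to \<open>m\<close>,
      \<open>G (Suc m)\<close> would have more than \<open>m\<close> elements.\<close>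
    have "d \<le> card (G d)" if "d \<le> Suc m" for d
      using that
    proof (induction d)
      case (Suc d)
      then have "G (Suc d) \<noteq> G d" using no by simp
      then have "G d \<subset> G (Suc d)" using mono[of d "Suc d"] by (simp add: psubset_eq)
      moreover have "finite (G (Suc d))" by (rule finite_subset[OF sub fin])
      ultimately have "card (G d) < card (G (Suc d))" by (intro psubset_card_mono)
      moreover have "d \<le> card (G d)" using Suc by simp
      ultimately show ?case by linarith
    qed simp
    from this[of "Suc m"] have "Suc m \<le> card (G (Suc m))" by simp
    also have "\<dots> \<le> card (generated S A ?X)" by (rule card_mono[OF fin sub])
    finally show False using card by linarith
  qed
  then obtain d where d: "d \<le> m" "G (Suc d) = G d" by blast
  have "generated S A ?X = G m"
    by (rule equalityI[OF subset_trans[OF stable[OF d(2)] mono[OF d(1)]] sub])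
  then show ?thesis by (simp only: G_def)
qed


section \<open>Finitely many formulas determine the game in uniformly locally finite classes\<close>

definition atoms_upto :: "('f, 'r) signature \<Rightarrow> nat \<Rightarrow> nat \<Rightarrow> ('f, 'r) form set" where
  "atoms_upto S n d = (\<lambda>(s, t). Eq s t) ` (terms_upto S n d \<times> terms_upto S n d) \<union>
     (\<Union>r\<in>rels S. Rel r ` {ts. set ts \<subseteq> terms_upto S n d \<and> length ts = rel_arity S r})"

lemma finite_atoms_upto: "finite_signature S \<Longrightarrow> finite (atoms_upto S n d)"
  by (auto simp: atoms_upto_def finite_signature_def finite_terms_upto
      intro!: finite_lists_length_eq)

lemma atoms_upto_wf: "p \<in> atoms_upto S n d \<Longrightarrow> wf_form S p \<and> free_vars p \<subseteq> {..<n}"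
  by (fastforce simp: atoms_upto_def dest: terms_upto_wf)

text \<open>The isomorphism sends the value of a term in \<open>A\<close> to the value of the same
  term in \<open>B\<close>. Depth \<open>m\<close> names every generated element; the extra level
  covers an operation applied to such names.\<close>

lemma duplicator_wins_if_atoms_agree:
  fixes A :: "('f, 'r, 'a) struct" and B :: "('f, 'r, 'b) struct"
  assumes A: "finite (generated S A (e ` {..<n}))" "card (generated S A (e ` {..<n})) \<le> m"
    and B: "finite (generated S B (e' ` {..<n}))" "card (generated S B (e' ` {..<n})) \<le> m"
    and agree: "\<forall>p\<in>atoms_upto S n (Suc m). sat A e p \<longleftrightarrow> sat B e' p"
  shows "duplicator_wins S A B (map (\<lambda>i. (e i, e' i)) [0..<n])"
proof -
  let ?ps = "map (\<lambda>i. (e i, e' i)) [0..<n]"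
  let ?T = "terms_upto S n m" and ?T' = "terms_upto S n (Suc m)"
  let ?v = "tm_val A e" and ?w = "tm_val B e'"
  have sub: "?T \<subseteq> ?T'" by (intro terms_upto_mono) simp
  have fst: "fst ` set ?ps = e ` {..<n}" and snd: "snd ` set ?ps = e' ` {..<n}"
    by (auto simp: image_image atLeast0LessThan)
  have genA: "generated S A (e ` {..<n}) = ?v ` ?T" and genB: "generated S B (e' ` {..<n}) = ?w ` ?T"
    by (rule generated_eq_terms_upto[OF A], rule generated_eq_terms_upto[OF B])
  have eq: "?v s = ?v t \<longleftrightarrow> ?w s = ?w t" if "s \<in> ?T'" "t \<in> ?T'" for s t
  proof -
    have "Eq s t \<in> atoms_upto S n (Suc m)"
      unfolding atoms_upto_def using that by (intro UnI1 image_eqI[of _ _ "(s, t)"]) simp_all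
    with agree have "sat A e (Eq s t) \<longleftrightarrow> sat B e' (Eq s t)" by blast
    then show ?thesis by simp
  qed
  have rel: "map ?v ts \<in> rel_interp A r \<longleftrightarrow> map ?w ts \<in> rel_interp B r"
    if "r \<in> rels S" "length ts = rel_arity S r" "set ts \<subseteq> ?T'" for r ts
  proof -
    have "Rel r ts \<in> atoms_upto S n (Suc m)" unfolding atoms_upto_def using that by blast
    with agree have "sat A e (Rel r ts) \<longleftrightarrow> sat B e' (Rel r ts)" by blast
    then show ?thesis by simp
  qed
  define h where "h x = ?w (SOME t. t \<in> ?T \<and> ?v t = x)" for x
  \<comment> \<open>Independence of the chosen name: \<open>t\<close> and the depth-\<open>m\<close>
    name of its value agree in \<open>A\<close>, and this equation is among the atoms, hence holds
    in \<open>B\<close>.\<close>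
  have h: "h (?v t) = ?w t" if t: "t \<in> ?T'" for t
  proof -
    have "?v t \<in> generated S A (e ` {..<n})"
      using terms_upto_wf[OF t] by (intro tm_val_generated image_mono) blast+
    then have "\<exists>s. s \<in> ?T \<and> ?v s = ?v t" unfolding genA by (metis imageE)
    then have s: "(SOME s. s \<in> ?T \<and> ?v s = ?v t) \<in> ?T"
        "?v (SOME s. s \<in> ?T \<and> ?v s = ?v t) = ?v t"
      by (metis (mono_tags, lifting) someI_ex)+
    then show ?thesis unfolding h_def using eq[OF subsetD[OF sub s(1)] t] by simp
  qed
  have map_h: "map h (map ?v ts) = map ?w ts" if "set ts \<subseteq> ?T" for ts
    using h[OF subsetD[OF sub subsetD[OF that]]] by simp
  have bij: "bij_betw h (?v ` ?T) (?w ` ?T)"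
  proof (rule bij_betw_imageI)
    show "inj_on h (?v ` ?T)"
    proof (rule inj_onI, elim imageE)
      fix x y s t assume "h x = h y" "x = ?v s" "s \<in> ?T" "y = ?v t" "t \<in> ?T"
      then show "x = y"
        using h[OF subsetD[OF sub]] eq[OF subsetD[OF sub] subsetD[OF sub], of s t] by simp
    qed
    show "h ` ?v ` ?T = ?w ` ?T"
      unfolding image_image by (intro image_cong refl h subsetD[OF sub])
  qed
  have "h (op_interp A f xs) = op_interp B f (map h xs)"
    if f: "f \<in> ops S" and xs: "xs \<in> tuples (?v ` ?T) (op_arity S f)" for f xs
  proof -
    obtain ts where ts: "set ts \<subseteq> ?T" "xs = map ?v ts"
      using xs subset_image_list[of xs ?v ?T] by (auto simp: tuples_def)
    have "App f ts \<in> ?T'" using f xs ts by (intro App_terms_upto) (auto simp: tuples_def)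
    then have "h (?v (App f ts)) = ?w (App f ts)" by (rule h)
    then show ?thesis using map_h[OF ts(1)] ts(2) by (metis tm_val.simps(2))
  qed
  moreover have "xs \<in> rel_interp A r \<longleftrightarrow> map h xs \<in> rel_interp B r"
    if r: "r \<in> rels S" and xs: "xs \<in> tuples (?v ` ?T) (rel_arity S r)" for r xs
  proof -
    obtain ts where ts: "set ts \<subseteq> ?T" "xs = map ?v ts"
      using xs subset_image_list[of xs ?v ?T] by (auto simp: tuples_def)
    have "length ts = rel_arity S r" using xs ts by (auto simp: tuples_def)
    then show ?thesis using rel[OF r _ subset_trans[OF ts(1) sub]] map_h[OF ts(1)] ts(2) by metis
  qed
  ultimately have "is_iso S (gen_substructure S A (fst ` set ?ps)) (gen_substructure S B (snd ` set ?ps)) h"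
    unfolding fst snd is_iso_def gen_substructure_def using bij genA genB by simp
  moreover have "h (e i) = e' i" if "i < n" for i
  proof -
    have "Var i \<in> ?T'" using that terms_upto_mono[of 0 "Suc m" S n] by auto
    from h[OF this] show ?thesis by simp
  qed
  ultimately show ?thesis unfolding duplicator_wins_def by auto
qed

section \<open>Boolean combinations of finitely many formulas\<close>

lemma finite_conjunction:
  assumes "finite F" "\<forall>p\<in>F. wf_form S p \<and> free_vars p \<subseteq> V"
  shows "\<exists>q. wf_form S q \<and> free_vars q \<subseteq> V \<and>
    (\<forall>(A :: ('f, 'r, 'a) struct) e. sat A e q \<longleftrightarrow> (\<forall>p\<in>F. sat A e p))"
  using assms
proof (induction F)
  \<comment> \<open>The empty conjunction is a valid sentence; quantifying the variable keeps it
    within any \<open>V\<close>, even the empty one.\<close>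
  case empty
  show ?case by (rule exI[of _ "All 0 (Eq (Var 0) (Var 0))"]) simp
next
  case (insert p F)
  then obtain q where "wf_form S q" "free_vars q \<subseteq> V"
    "\<forall>(A :: ('f, 'r, 'a) struct) e. sat A e q \<longleftrightarrow> (\<forall>p\<in>F. sat A e p)" by auto
  then show ?case using insert.prems by (intro exI[of _ "Conj p q"]) simp
qed

lemma finite_disjunction:
  assumes "finite F" "\<forall>p\<in>F. wf_form S p \<and> free_vars p \<subseteq> V"
  shows "\<exists>q. wf_form S q \<and> free_vars q \<subseteq> V \<and>
    (\<forall>(A :: ('f, 'r, 'a) struct) e. sat A e q \<longleftrightarrow> (\<exists>p\<in>F. sat A e p))"
proof -
  have "finite (Neg ` F)" "\<forall>p\<in>Neg ` F. wf_form S p \<and> free_vars p \<subseteq> V" using assms by auto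
  from finite_conjunction[OF this, where 'a = 'a] obtain q where q: "wf_form S q" "free_vars q \<subseteq> V"
    "\<forall>(A :: ('f, 'r, 'a) struct) e. sat A e q \<longleftrightarrow> (\<forall>p\<in>Neg ` F. sat A e p)" by blast
  then show ?thesis by (intro exI[of _ "Neg q"]) auto
qed

text \<open>The conjunction of all members of \<open>F\<close>, negated when outside
  \<open>Y\<close>, pins down exactly which of them hold.\<close>

lemma complete_type:
  assumes "finite F" "\<forall>p\<in>F. wf_form S p \<and> free_vars p \<subseteq> V"
  shows "\<exists>q. wf_form S q \<and> free_vars q \<subseteq> V \<and>
    (\<forall>(A :: ('f, 'r, 'a) struct) e. sat A e q \<longleftrightarrow> (\<forall>p\<in>F. sat A e p \<longleftrightarrow> p \<in> Y))"
proof -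
  let ?F = "(\<lambda>p. if p \<in> Y then p else Neg p) ` F"
  have fin: "finite ?F" using assms(1) by simp
  have wf: "\<forall>p\<in>?F. wf_form S p \<and> free_vars p \<subseteq> V"
  proof (rule ballI, erule imageE)
    fix q p assume "q = (if p \<in> Y then p else Neg p)" "p \<in> F"
    then show "wf_form S q \<and> free_vars q \<subseteq> V" using assms(2) by (cases "p \<in> Y") simp_all
  qed
  from finite_conjunction[OF fin wf, where 'a = 'a] obtain q where q: "wf_form S q" "free_vars q \<subseteq> V"
    and sat_q: "\<forall>(A :: ('f, 'r, 'a) struct) e. sat A e q \<longleftrightarrow> (\<forall>p\<in>?F. sat A e p)" by blast
  have literal: "sat A e (if p \<in> Y then p else Neg p) \<longleftrightarrow> (sat A e p \<longleftrightarrow> p \<in> Y)"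
    for A :: "('f, 'r, 'a) struct" and e p
    by simp
  have "sat A e q \<longleftrightarrow> (\<forall>p\<in>F. sat A e p \<longleftrightarrow> p \<in> Y)" for A :: "('f, 'r, 'a) struct" and e
    unfolding sat_q[rule_format] ball_simps(9) literal by (rule refl)
  then show ?thesis using q by (intro exI[of _ q] conjI allI)
qed

section \<open>Formulas determining the outcome with \<open>j\<close> rounds left\<close>

text \<open>A position after \<open>k\<close> rounds is encoded by two valuations: variable
  \<open>i\<close> holds the elements chosen in round \<open>i\<close>, counting from zero.\<close>

definition determines_back_forth ::
    "('f, 'r) signature \<Rightarrow> ('f, 'r, 'a) struct set \<Rightarrow> nat \<Rightarrow> nat \<Rightarrow> ('f, 'r) form set \<Rightarrow> bool" where
  "determines_back_forth S U k j F \<longleftrightarrow>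
    (\<forall>A\<in>U. \<forall>B\<in>U. \<forall>e e'. e ` {..<k} \<subseteq> carrier A \<longrightarrow> e' ` {..<k} \<subseteq> carrier B \<longrightarrow>
      (\<forall>p\<in>F. sat A e p \<longleftrightarrow> sat B e' p) \<longrightarrow>
      back_forth S j A B (map (\<lambda>i. (e i, e' i)) [0..<k]))"

text \<open>Induction on the rounds left, starting from finished games, so that a single bound
  \<open>m\<close> for \<open>n\<close> generators suffices throughout. Each step back binds the
  variable of the next round.\<close>

lemma finite_formulas_determine_back_forth:
  fixes U :: "('f, 'r, 'a) struct set"
  assumes S: "finite_signature S"
    and m: "\<forall>A\<in>U. \<forall>X. X \<subseteq> carrier A \<longrightarrow> finite X \<longrightarrow> card X \<le> n \<longrightarrow>
      finite (generated S A X) \<and> card (generated S A X) \<le> m"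
  shows "j \<le> n \<Longrightarrow> \<exists>F. finite F \<and> (\<forall>p\<in>F. wf_form S p \<and> free_vars p \<subseteq> {..<n - j}) \<and>
    determines_back_forth S U (n - j) j F"
proof (induction j)
  case 0
  have gen: "finite (generated S A (e ` {..<n})) \<and> card (generated S A (e ` {..<n})) \<le> m"
    if "A \<in> U" "e ` {..<n} \<subseteq> carrier A" for A e
    using m that card_image_le[of "{..<n}" e] by simp
  have "determines_back_forth S U n 0 (atoms_upto S n (Suc m))"
    unfolding determines_back_forth_def back_forth.simps
  proof (intro ballI allI impI)
    fix A B :: "('f, 'r, 'a) struct" and e e' :: "nat \<Rightarrow> 'a"
    assume "A \<in> U" "B \<in> U" "e ` {..<n} \<subseteq> carrier A" "e' ` {..<n} \<subseteq> carrier B"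
      and agree: "\<forall>p\<in>atoms_upto S n (Suc m). sat A e p \<longleftrightarrow> sat B e' p"
    then have "finite (generated S A (e ` {..<n})) \<and> card (generated S A (e ` {..<n})) \<le> m"
      "finite (generated S B (e' ` {..<n})) \<and> card (generated S B (e' ` {..<n})) \<le> m"
      using gen by blast+
    then show "duplicator_wins S A B (map (\<lambda>i. (e i, e' i)) [0..<n])"
      using agree by (intro duplicator_wins_if_atoms_agree[where m = m]) blast+
  qed
  then show ?case
    using finite_atoms_upto[OF S] atoms_upto_wf[of _ S n "Suc m"] by (metis diff_zero)
next
  case (Suc j)
  define k where "k = n - Suc j"
  have k: "n - j = Suc k" using Suc.prems by (simp add: k_def Suc_diff_Suc)
  have "j \<le> n" using Suc.prems by simp
  then obtain F where F: "finite F" "\<forall>p\<in>F. wf_form S p \<and> free_vars p \<subseteq> {..<Suc k}"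
    and bf: "determines_back_forth S U (Suc k) j F"
    using Suc.IH unfolding k by blast
  obtain c where c: "\<And>Y. wf_form S (c Y) \<and> free_vars (c Y) \<subseteq> {..<Suc k}"
    and sat_c: "\<And>Y (A :: ('f, 'r, 'a) struct) e.
      sat A e (c Y) \<longleftrightarrow> (\<forall>p\<in>F. sat A e p \<longleftrightarrow> p \<in> Y)"
    using complete_type[OF F, where 'a = 'a] by metis
  \<comment> \<open>One formula for each \<open>Y \<subseteq> F\<close>, stating that some next
    element realises the type \<open>Y\<close>.\<close>
  let ?F = "(\<lambda>Y. Ex k (c Y)) ` Pow F"
  have "finite ?F" using F(1) by simp
  moreover have "\<forall>p\<in>?F. wf_form S p \<and> free_vars p \<subseteq> {..<k}"
  proof (rule ballI, erule imageE)
    fix p Y assume "p = Ex k (c Y)"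
    then show "wf_form S p \<and> free_vars p \<subseteq> {..<k}" using c[of Y] by (auto simp: lessThan_Suc)
  qed
  moreover have "determines_back_forth S U k (Suc j) ?F"
    unfolding determines_back_forth_def
  proof (intro ballI allI impI)
    fix A B :: "('f, 'r, 'a) struct" and e e' :: "nat \<Rightarrow> 'a"
    assume A: "A \<in> U" "e ` {..<k} \<subseteq> carrier A" and B: "B \<in> U" "e' ` {..<k} \<subseteq> carrier B"
      and agree: "\<forall>p\<in>?F. sat A e p \<longleftrightarrow> sat B e' p"
    \<comment> \<open>Both structures therefore offer the same types over \<open>F\<close> for the
      next choice.\<close>
    have ex: "(\<exists>a\<in>carrier A. \<forall>p\<in>F. sat A (e(k := a)) p \<longleftrightarrow> p \<in> Y) \<longleftrightarrow>
        (\<exists>b\<in>carrier B. \<forall>p\<in>F. sat B (e'(k := b)) p \<longleftrightarrow> p \<in> Y)" if "Y \<subseteq> F" for Y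
    proof -
      have "sat A e (Ex k (c Y)) \<longleftrightarrow> sat B e' (Ex k (c Y))" using agree that by blast
      then show ?thesis by (simp add: sat_c)
    qed
    have next_round: "back_forth S j A B (map (\<lambda>i. (e i, e' i)) [0..<k] @ [(a, b)])"
      if "a \<in> carrier A" "b \<in> carrier B"
        "\<forall>p\<in>F. sat A (e(k := a)) p \<longleftrightarrow> sat B (e'(k := b)) p" for a b
    proof -
      let ?e = "e(k := a)" and ?e' = "e'(k := b)"
      have "?e ` {..<Suc k} \<subseteq> carrier A" "?e' ` {..<Suc k} \<subseteq> carrier B"
        using A(2) B(2) that(1,2) by (auto simp: lessThan_Suc)
      then have "back_forth S j A B (map (\<lambda>i. (?e i, ?e' i)) [0..<Suc k])"
        using bf A(1) B(1) that(3) unfolding determines_back_forth_def by blast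
      moreover have "map (\<lambda>i. (?e i, ?e' i)) [0..<Suc k] = map (\<lambda>i. (e i, e' i)) [0..<k] @ [(a, b)]"
        by simp
      ultimately show ?thesis by (simp only:)
    qed
    have "\<exists>b\<in>carrier B. back_forth S j A B (map (\<lambda>i. (e i, e' i)) [0..<k] @ [(a, b)])"
      if a: "a \<in> carrier A" for a
    proof -
      \<comment> \<open>The type of Spoiler's element. Duplicator answers with an element of
        \<open>B\<close> of the same type, so the extended valuations agree on
        \<open>F\<close>.\<close>
      let ?Y = "{p\<in>F. sat A (e(k := a)) p}"
      have "\<exists>a\<in>carrier A. \<forall>p\<in>F. sat A (e(k := a)) p \<longleftrightarrow> p \<in> ?Y" using a by blast
      then obtain b where "b \<in> carrier B" "\<forall>p\<in>F. sat B (e'(k := b)) p \<longleftrightarrow> p \<in> ?Y"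
        using ex[of ?Y] by blast
      then show ?thesis using next_round[OF a] by blast
    qed
    moreover have "\<exists>a\<in>carrier A. back_forth S j A B (map (\<lambda>i. (e i, e' i)) [0..<k] @ [(a, b)])"
      if b: "b \<in> carrier B" for b
    proof -
      let ?Y = "{p\<in>F. sat B (e'(k := b)) p}"
      have "\<exists>b\<in>carrier B. \<forall>p\<in>F. sat B (e'(k := b)) p \<longleftrightarrow> p \<in> ?Y" using b by blast
      then obtain a where "a \<in> carrier A" "\<forall>p\<in>F. sat A (e(k := a)) p \<longleftrightarrow> p \<in> ?Y"
        using ex[of ?Y] by blast
      then show ?thesis using next_round[OF _ b] by blast
    qed
    ultimately show "back_forth S (Suc j) A B (map (\<lambda>i. (e i, e' i)) [0..<k])" by simp
  qed
  ultimately show ?case unfolding k_def[symmetric] by (intro exI[of _ ?F]) blast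
qed

section \<open>Defining a property that is invariant under the game\<close>

text \<open>The defining sentence is the disjunction of the complete types over \<open>F\<close>
  realised by members of \<open>U\<close> with property \<open>P\<close>. A member of
  \<open>U\<close> satisfying it is \<open>ef_equiv\<close> to one with \<open>P\<close>.\<close>

lemma ef_invariant_expressible_within:
  fixes S :: "('f, 'r) signature" and U :: "('f, 'r, 'a) struct set"
  assumes S: "finite_signature S" and U: "uniformly_locally_finite S U"
    and nonempty: "\<forall>A\<in>U. carrier A \<noteq> {}"
    and inv: "\<And>A B. A \<in> U \<Longrightarrow> B \<in> U \<Longrightarrow> ef_equiv S n A B \<Longrightarrow> P A \<Longrightarrow> P B"
  shows "fo_expressible_within S U P"
proof -
  obtain m where "\<forall>A\<in>U. \<forall>X. X \<subseteq> carrier A \<longrightarrow> finite X \<longrightarrow> card X \<le> n \<longrightarrow>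
      finite (generated S A X) \<and> card (generated S A X) \<le> m"
    using U unfolding uniformly_locally_finite_def by meson
  from finite_formulas_determine_back_forth[OF S this order_refl]
  obtain F where F: "finite F" "\<forall>p\<in>F. wf_form S p \<and> free_vars p \<subseteq> {}"
    and "determines_back_forth S U 0 n F"
    unfolding diff_self_eq_0 lessThan_0 by blast
  \<comment> \<open>With no round played, the carrier conditions on \<open>e\<close> and
    \<open>e'\<close> are vacuous and the position is empty.\<close>
  then have determined: "\<forall>A\<in>U. \<forall>B\<in>U. \<forall>e e'. (\<forall>p\<in>F. sat A e p \<longleftrightarrow> sat B e' p) \<longrightarrow> ef_equiv S n A B"
    unfolding ef_equiv_iff_back_forth determines_back_forth_def lessThan_0 upt_0 by simp
  then have ef: "ef_equiv S n A B"
    if "A \<in> U" "B \<in> U" "\<forall>p\<in>F. sat A e p \<longleftrightarrow> sat B e' p" for A B e e'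
    using that by blast
  obtain c where c: "\<And>Y. wf_form S (c Y) \<and> free_vars (c Y) \<subseteq> {}"
    and sat_c: "\<And>Y (A :: ('f, 'r, 'a) struct) e.
      sat A e (c Y) \<longleftrightarrow> (\<forall>p\<in>F. sat A e p \<longleftrightarrow> p \<in> Y)"
    using complete_type[OF F, where 'a = 'a] by metis
  \<comment> \<open>\<open>U\<close> may be infinite, but only finitely many types over
    \<open>F\<close> exist, so the disjunction is finite.\<close>
  let ?Y = "{Y\<in>Pow F. \<exists>A\<in>U. P A \<and> (\<exists>e. Y = {p\<in>F. sat A e p})}"
  have "finite (c ` ?Y)" "\<forall>p\<in>c ` ?Y. wf_form S p \<and> free_vars p \<subseteq> {}" using F(1) c by auto
  from finite_disjunction[OF this, where 'a = 'a]
  obtain q where "wf_form S q" "free_vars q \<subseteq> {}"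
    and q: "\<forall>(A :: ('f, 'r, 'a) struct) e. sat A e q \<longleftrightarrow> (\<exists>p\<in>c ` ?Y. sat A e p)"
    by blast
  then have sentence_q: "sentence S q" by (simp add: sentence_def)
  have sat_q: "sat A e q \<longleftrightarrow>
      (\<exists>B\<in>U. P B \<and> (\<exists>e'. \<forall>p\<in>F. sat A e p \<longleftrightarrow> sat B e' p))"
    for A :: "('f, 'r, 'a) struct" and e
  proof -
    have "sat A e q \<longleftrightarrow> (\<exists>Y\<in>?Y. \<forall>p\<in>F. sat A e p \<longleftrightarrow> p \<in> Y)"
      unfolding q[rule_format] bex_simps sat_c by (rule refl)
    also have "\<dots> \<longleftrightarrow> (\<exists>B\<in>U. P B \<and> (\<exists>e'. \<forall>p\<in>F. sat A e p \<longleftrightarrow> sat B e' p))" (is "?L \<longleftrightarrow> ?R")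
    proof
      assume ?L
      then obtain B e' where "B \<in> U" "P B" "\<forall>p\<in>F. sat A e p \<longleftrightarrow> p \<in> {p\<in>F. sat B e' p}" by blast
      then show ?R by simp blast
    next
      assume ?R
      then obtain B e' where B: "B \<in> U" "P B" "\<forall>p\<in>F. sat A e p \<longleftrightarrow> sat B e' p" by blast
      then have "{p\<in>F. sat B e' p} \<in> ?Y" by blast
      moreover have "\<forall>p\<in>F. sat A e p \<longleftrightarrow> p \<in> {p\<in>F. sat B e' p}" using B(3) by simp
      ultimately show ?L by (rule bexI[rotated])
    qed
    finally show ?thesis .
  qed
  have "models A q \<longleftrightarrow> P A" if A: "A \<in> U" for A
  proof
    assume "P A"
    then have "sat A e q" for e unfolding sat_q using A by blast
    then show "models A q" by (simp add: models_def)
  next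
    assume "models A q"
    obtain a where "a \<in> carrier A" using nonempty A by blast
    then have "sat A (\<lambda>_. a) q" using \<open>models A q\<close> by (auto simp: models_def)
    then obtain B e where "B \<in> U" "P B" "\<forall>p\<in>F. sat A (\<lambda>_. a) p \<longleftrightarrow> sat B e p"
      unfolding sat_q by blast
    then have "ef_equiv S n B A" using ef[of B A e "\<lambda>_. a"] A by simp
    then show "P A" using inv[OF \<open>B \<in> U\<close> A] \<open>P B\<close> by simp
  qed
  with sentence_q show ?thesis unfolding fo_expressible_within_def by blast
qed

theorem theorem5p2:
  fixes S :: "('f, 'r) signature"
    and P :: "('f, 'r, 'a) struct \<Rightarrow> bool"
    and U :: "('f, 'r, 'a) struct set"
  assumes "finite_signature S"
    and "iso_invariant S P"
  shows "((\<forall>n. \<exists>A B. finite_structure S A \<and> finite_structure S B \<and>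
              ef_equiv S n A B \<and> P A \<and> \<not> P B) \<longrightarrow> \<not> fo_expressible S P) \<and>
         ((\<forall>A\<in>U. finite_structure S A) \<longrightarrow> uniformly_locally_finite S U \<longrightarrow>
            \<not> fo_expressible_within S U P \<longrightarrow>
            (\<forall>n. \<exists>A\<in>U. \<exists>B\<in>U. ef_equiv S n A B \<and> P A \<and> \<not> P B))"
proof (intro conjI impI notI)
  assume sep: "\<forall>n. \<exists>A B. finite_structure S A \<and> finite_structure S B \<and>
      ef_equiv S n A B \<and> P A \<and> \<not> P B"
    and "fo_expressible S P"
  then obtain p where p: "sentence S p" "\<And>A. finite_structure S A \<Longrightarrow> models A p \<longleftrightarrow> P A"
    by (auto simp: fo_expressible_def fo_expressible_within_def)
  \<comment> \<open>The number of rounds is the quantifier rank of the supposed defining sentence,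
    so the pair agrees on it.\<close>
  from sep obtain A B where AB: "finite_structure S A" "finite_structure S B"
      "ef_equiv S (quantifier_rank p) A B" "P A" "\<not> P B"
    by blast
  then have "carrier A \<noteq> {}" by (simp add: finite_structure_def)
  from ef_equiv_models[OF this AB(3) p(1)] show False using p(2) AB by simp
next
  assume "\<forall>A\<in>U. finite_structure S A" "uniformly_locally_finite S U"
    "\<not> fo_expressible_within S U P"
  \<comment> \<open>By contraposition: if no pair in \<open>U\<close> is separated for some
    \<open>n\<close>, then \<open>P\<close> passes along \<open>ef_equiv S n\<close> within
    \<open>U\<close> and is expressible there.\<close>
  then show "\<forall>n. \<exists>A\<in>U. \<exists>B\<in>U. ef_equiv S n A B \<and> P A \<and> \<not> P B"
    using ef_invariant_expressible_within[OF assms(1), of U _ P]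
    unfolding finite_structure_def by blast
qed

end
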